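(* Let $(X,m,\delta,e,\epsilon)$ and $(X',m',\delta',e',\epsilon')$ be two Frobenius algebras in a monoidal category $\mathcal{C}$. Let $f\in\mathrm{Hom}_{\mathcal{C}}(X',X)$ be an algebra morphism such that $f^{**}=f$, and define $g:=f\circ f^*\in\mathrm{End}_{\mathcal C}(X)$. Then $$(g\otimes \mathrm{id}_X)\circ\delta\circ g=(g\otimes g)\circ\delta=(\mathrm{id}_X\otimes g)\circ\delta\circ g .$$
   Context: Monoidal categories are taken strict. A left dual of $X$ is $(X^*,\mathrm{ev}_X:X^*\otimes X\to\mathbf 1,\mathrm{coev}_X:\mathbf 1\to X\otimes X^* )$ satisfying the zigzag identities; for $f:X\to Y$, $f^*:Y^*\to X^*$ is $(\mathrm{ev}_Y\otimes \mathrm{id}_{X^*})\circ(\mathrm{id}_{Y^*}\otimes f\otimes \mathrm{id}_{X^*})\circ(\mathrm{id}_{Y^*}\otimes\mathrm{coev}_X)$. A Frobenius algebra is $(X,m,\delta,e,\epsilon)$ with $(X,m,e)$ a unital algebra, $(X,\delta,\epsilon)$ a counital coalgebra and $(\mathrm{id}_X\otimes m)\circ(\delta\otimes \mathrm{id}_X)=\delta\circ m=(m\otimes \mathrm{id}_X)\circ(\mathrm{id}_X\otimes\delta)$. It is always regarded as selfdual, $X^*=X$, with $\mathrm{ev}_X=\epsilon\circ m$ and $\mathrm{coev}_X=\delta\circ e$; so for $f:X'\to X$ between Frobenius algebras, $f^*:X\to X'$ and $f^{**}:X'\to X$. An algebra morphism $f:X'\to X$ is a morphism with $m\circ(f\otimes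 f)=f\circ m'$ (unitality is not required). *)

theory Defs
  imports Main
begin

section \<open>Strict monoidal categories\<close>

record ('o, 'a) moncat =
  Ob :: "'o set"
  Arr :: "'a set"
  Dom :: "'a \<Rightarrow> 'o"
  Cod :: "'a \<Rightarrow> 'o"
  Ident :: "'o \<Rightarrow> 'a" (\<open>\<i>\<d>\<index>\<close>)
  Comp :: "'a \<Rightarrow> 'a \<Rightarrow> 'a" (infixr \<open>\<cdot>\<index>\<close> 60)
  TensOb :: "'o \<Rightarrow> 'o \<Rightarrow> 'o" (infixr \<open>\<otimes>\<^sub>o\<index>\<close> 70)
  TensArr :: "'a \<Rightarrow> 'a \<Rightarrow> 'a" (infixr \<open>\<otimes>\<index>\<close> 70)
  UnitOb :: "'o" (\<open>\<one>\<index>\<close>)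

definition Hom :: "('o, 'a, 'z) moncat_scheme \<Rightarrow> 'o \<Rightarrow> 'o \<Rightarrow> 'a set" where
  "Hom C X Y = {f \<in> Arr C. Dom C f = X \<and> Cod C f = Y}"

locale strict_monoidal_category =
  fixes C :: "('o, 'a, 'z) moncat_scheme" (structure)
  assumes dom_ob: "f \<in> Arr C \<Longrightarrow> Dom C f \<in> Ob C"
    and cod_ob: "f \<in> Arr C \<Longrightarrow> Cod C f \<in> Ob C"
    and id_hom: "X \<in> Ob C \<Longrightarrow> \<i>\<d> X \<in> Hom C X X"
    and comp_hom: "\<lbrakk>g \<in> Hom C Y Z; f \<in> Hom C X Y\<rbrakk> \<Longrightarrow> g \<cdot> f \<in> Hom C X Z"
    and id_left: "f \<in> Hom C X Y \<Longrightarrow> \<i>\<d> Y \<cdot> f = f"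
    and id_right: "f \<in> Hom C X Y \<Longrightarrow> f \<cdot> \<i>\<d> X = f"
    and comp_assoc:
      "\<lbrakk>h \<in> Hom C Y Z; g \<in> Hom C X Y; f \<in> Hom C W X\<rbrakk> \<Longrightarrow> (h \<cdot> g) \<cdot> f = h \<cdot> (g \<cdot> f)"
    and unit_ob: "\<one> \<in> Ob C"
    and tens_ob: "\<lbrakk>X \<in> Ob C; Y \<in> Ob C\<rbrakk> \<Longrightarrow> X \<otimes>\<^sub>o Y \<in> Ob C"
    and tens_hom:
      "\<lbrakk>f \<in> Hom C X Y; g \<in> Hom C Z W\<rbrakk> \<Longrightarrow> f \<otimes> g \<in> Hom C (X \<otimes>\<^sub>o Z) (Y \<otimes>\<^sub>o W)"
    and tens_id: "\<lbrakk>X \<in> Ob C; Y \<in> Ob C\<rbrakk> \<Longrightarrow> \<i>\<d> X \<otimes> \<i>\<d> Y = \<i>\<d> (X \<otimes>\<^sub>o Y)"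
    and interchange:
      "\<lbrakk>f \<in> Hom C X Y; f' \<in> Hom C Y Z; g \<in> Hom C U V; g' \<in> Hom C V W\<rbrakk>
        \<Longrightarrow> (f' \<otimes> g') \<cdot> (f \<otimes> g) = (f' \<cdot> f) \<otimes> (g' \<cdot> g)"
    and tens_ob_assoc:
      "\<lbrakk>X \<in> Ob C; Y \<in> Ob C; Z \<in> Ob C\<rbrakk> \<Longrightarrow> (X \<otimes>\<^sub>o Y) \<otimes>\<^sub>o Z = X \<otimes>\<^sub>o (Y \<otimes>\<^sub>o Z)"
    and tens_ob_unit_left: "X \<in> Ob C \<Longrightarrow> \<one> \<otimes>\<^sub>o X = X"
    and tens_ob_unit_right: "X \<in> Ob C \<Longrightarrow> X \<otimes>\<^sub>o \<one> = X"
    and tens_assoc: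
      "\<lbrakk>f \<in> Arr C; g \<in> Arr C; h \<in> Arr C\<rbrakk> \<Longrightarrow> (f \<otimes> g) \<otimes> h = f \<otimes> (g \<otimes> h)"
    and tens_unit_left: "f \<in> Arr C \<Longrightarrow> \<i>\<d> \<one> \<otimes> f = f"
    and tens_unit_right: "f \<in> Arr C \<Longrightarrow> f \<otimes> \<i>\<d> \<one> = f"


section \<open>Left duals\<close>

record ('o, 'a) dual_data =
  dual_ob :: "'o"
  ev :: "'a"
  coev :: "'a"

locale left_dual = strict_monoidal_category C
  for C :: "('o, 'a, 'z) moncat_scheme" (structure) +
  fixes X :: "'o" and D :: "('o, 'a) dual_data"
  assumes ob: "X \<in> Ob C"
    and dual_ob: "dual_ob D \<in> Ob C"
    and ev_hom: "ev D \<in> Hom C (dual_ob D \<otimes>\<^sub>o X) \<one>"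
    and coev_hom: "coev D \<in> Hom C \<one> (X \<otimes>\<^sub>o dual_ob D)"
    and zigzag_ob: "(\<i>\<d> X \<otimes> ev D) \<cdot> (coev D \<otimes> \<i>\<d> X) = \<i>\<d> X"
    and zigzag_dual:
      "(ev D \<otimes> \<i>\<d> (dual_ob D)) \<cdot> (\<i>\<d> (dual_ob D) \<otimes> coev D) = \<i>\<d> (dual_ob D)"

text \<open>For \<open>f : X \<rightarrow> Y\<close>, and \<open>DX\<close>, \<open>DY\<close> the chosen duals of \<open>X\<close> and \<open>Y\<close>, this is
  \<open>f\<^sup>* : Y\<^sup>* \<rightarrow> X\<^sup>*\<close>.\<close>

definition transpose ::
    "('o, 'a, 'z) moncat_scheme \<Rightarrow> ('o, 'a) dual_data \<Rightarrow> ('o, 'a) dual_data \<Rightarrow> 'a \<Rightarrow> 'a" where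
  "transpose C DX DY f =
     (ev DY \<otimes>\<^bsub>C\<^esub> \<i>\<d>\<^bsub>C\<^esub> (dual_ob DX))
     \<cdot>\<^bsub>C\<^esub> (\<i>\<d>\<^bsub>C\<^esub> (dual_ob DY) \<otimes>\<^bsub>C\<^esub> f \<otimes>\<^bsub>C\<^esub> \<i>\<d>\<^bsub>C\<^esub> (dual_ob DX))
     \<cdot>\<^bsub>C\<^esub> (\<i>\<d>\<^bsub>C\<^esub> (dual_ob DY) \<otimes>\<^bsub>C\<^esub> coev DX)"


section \<open>Frobenius algebras\<close>

locale unital_algebra = strict_monoidal_category C
  for C :: "('o, 'a, 'z) moncat_scheme" (structure) +
  fixes X :: "'o" and m e :: "'a"
  assumes alg_ob: "X \<in> Ob C"
    and mult_hom: "m \<in> Hom C (X \<otimes>\<^sub>o X) X"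
    and unit_hom: "e \<in> Hom C \<one> X"
    and mult_assoc: "m \<cdot> (m \<otimes> \<i>\<d> X) = m \<cdot> (\<i>\<d> X \<otimes> m)"
    and mult_unit_left: "m \<cdot> (e \<otimes> \<i>\<d> X) = \<i>\<d> X"
    and mult_unit_right: "m \<cdot> (\<i>\<d> X \<otimes> e) = \<i>\<d> X"

locale counital_coalgebra = strict_monoidal_category C
  for C :: "('o, 'a, 'z) moncat_scheme" (structure) +
  fixes X :: "'o" and \<delta> \<epsilon> :: "'a"
  assumes coalg_ob: "X \<in> Ob C"
    and comult_hom: "\<delta> \<in> Hom C X (X \<otimes>\<^sub>o X)"
    and counit_hom: "\<epsilon> \<in> Hom C X \<one>"
    and comult_coassoc: "(\<delta> \<otimes> \<i>\<d> X) \<cdot> \<delta> = (\<i>\<d> X \<otimes> \<delta>) \<cdot> \<delta>"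
    and comult_counit_left: "(\<epsilon> \<otimes> \<i>\<d> X) \<cdot> \<delta> = \<i>\<d> X"
    and comult_counit_right: "(\<i>\<d> X \<otimes> \<epsilon>) \<cdot> \<delta> = \<i>\<d> X"

record ('o, 'a) frob_data =
  frob_ob :: "'o"
  frob_mult :: "'a"
  frob_comult :: "'a"
  frob_unit :: "'a"
  frob_counit :: "'a"

locale frobenius_algebra =
  unital_algebra C "frob_ob A" "frob_mult A" "frob_unit A" +
  counital_coalgebra C "frob_ob A" "frob_comult A" "frob_counit A"
  for C :: "('o, 'a, 'z) moncat_scheme" (structure) and A :: "('o, 'a) frob_data" +
  assumes frobenius_left:
      "(\<i>\<d> (frob_ob A) \<otimes> frob_mult A) \<cdot> (frob_comult A \<otimes> \<i>\<d> (frob_ob A))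
        = frob_comult A \<cdot> frob_mult A"
    and frobenius_right:
      "frob_comult A \<cdot> frob_mult A
        = (frob_mult A \<otimes> \<i>\<d> (frob_ob A)) \<cdot> (\<i>\<d> (frob_ob A) \<otimes> frob_comult A)"

text \<open>A Frobenius algebra is regarded as its own left dual.\<close>

definition self_dual ::
    "('o, 'a, 'z) moncat_scheme \<Rightarrow> ('o, 'a) frob_data \<Rightarrow> ('o, 'a) dual_data" where
  "self_dual C A =
     \<lparr>dual_ob = frob_ob A,
      ev = frob_counit A \<cdot>\<^bsub>C\<^esub> frob_mult A,
      coev = frob_comult A \<cdot>\<^bsub>C\<^esub> frob_unit A\<rparr>"

text \<open>For a morphism \<open>f\<close> from (the object of) \<open>A\<close> to \<open>B\<close>, \<open>star C A B f\<close> is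
  \<open>f\<^sup>*\<close>, a morphism from \<open>B\<close> to \<open>A\<close>.\<close>

definition star ::
    "('o, 'a, 'z) moncat_scheme \<Rightarrow> ('o, 'a) frob_data \<Rightarrow> ('o, 'a) frob_data \<Rightarrow> 'a \<Rightarrow> 'a" where
  "star C A B f = transpose C (self_dual C A) (self_dual C B) f"

text \<open>Not required to preserve the unit.\<close>

definition algebra_morphism ::
    "('o, 'a, 'z) moncat_scheme \<Rightarrow> ('o, 'a) frob_data \<Rightarrow> ('o, 'a) frob_data \<Rightarrow> 'a \<Rightarrow> bool" where
  "algebra_morphism C A B f \<longleftrightarrow>
     f \<in> Hom C (frob_ob A) (frob_ob B) \<and>
     frob_mult B \<cdot>\<^bsub>C\<^esub> (f \<otimes>\<^bsub>C\<^esub> f) = f \<cdot>\<^bsub>C\<^esub> frob_mult A"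


section \<open>The self-duality is a left duality\<close>

context strict_monoidal_category
begin

lemma HomD: "f \<in> Hom C X Y \<Longrightarrow> f \<in> Arr C \<and> X \<in> Ob C \<and> Y \<in> Ob C"
  by (auto simp: Hom_def dom_ob cod_ob)

lemma tens_comp_id_right:
  assumes "f \<in> Hom C X Y" "g \<in> Hom C Y Z" "W \<in> Ob C"
  shows "(g \<cdot> f) \<otimes> \<i>\<d> W = (g \<otimes> \<i>\<d> W) \<cdot> (f \<otimes> \<i>\<d> W)"
  using interchange[OF assms(1,2) id_hom id_hom, OF assms(3) assms(3)] assms
  by (simp add: id_left[OF id_hom])

lemma tens_comp_id_left:
  assumes "f \<in> Hom C X Y" "g \<in> Hom C Y Z" "W \<in> Ob C"
  shows "\<i>\<d> W \<otimes> (g \<cdot> f) = (\<i>\<d> W \<otimes> g) \<cdot> (\<i>\<d> W \<otimes> f)"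
  using interchange[OF id_hom id_hom assms(1,2), OF assms(3) assms(3)] assms
  by (simp add: id_left[OF id_hom])

lemma zigzag_shape:
  assumes "s \<in> Hom C W X" "t \<in> Hom C X Y" "u \<in> Hom C Y Z" "v \<in> Hom C Z V"
    "d \<in> Hom C X Q" "n \<in> Hom C Q Z" and eq: "u \<cdot> t = n \<cdot> d"
  shows "(v \<cdot> u) \<cdot> (t \<cdot> s) = (v \<cdot> n) \<cdot> (d \<cdot> s)"
proof -
  have "(v \<cdot> u) \<cdot> (t \<cdot> s) = v \<cdot> (u \<cdot> (t \<cdot> s))"
    by (rule comp_assoc[OF assms(4,3) comp_hom[OF assms(2,1)]])
  also have "u \<cdot> (t \<cdot> s) = (n \<cdot> d) \<cdot> s"
    by (simp only: comp_assoc[OF assms(3,2,1), symmetric] eq)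
  also have "\<dots> = n \<cdot> (d \<cdot> s)"
    by (rule comp_assoc[OF assms(6,5,1)])
  also have "v \<cdot> (n \<cdot> (d \<cdot> s)) = (v \<cdot> n) \<cdot> (d \<cdot> s)"
    by (rule comp_assoc[OF assms(4,6) comp_hom[OF assms(5,1)], symmetric])
  finally show ?thesis .
qed

end

lemma (in frobenius_algebra) left_dual_self: "left_dual C (frob_ob A) (self_dual C A)"
proof -
  let ?X = "frob_ob A" and ?m = "frob_mult A" and ?d = "frob_comult A"
    and ?e = "frob_unit A" and ?n = "frob_counit A"
  note X = alg_ob
  note h = mult_hom unit_hom comult_hom counit_hom id_hom[OF X]
  note u = tens_ob_unit_left[OF X] tens_ob_unit_right[OF X]
  have a: "(?X \<otimes>\<^sub>o ?X) \<otimes>\<^sub>o ?X = ?X \<otimes>\<^sub>o ?X \<otimes>\<^sub>o ?X" using tens_ob_assoc X by blast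
  have e1: "?e \<otimes> \<i>\<d> ?X \<in> Hom C ?X (?X \<otimes>\<^sub>o ?X)" using tens_hom[OF h(2) h(5)] u by simp
  have e2: "\<i>\<d> ?X \<otimes> ?e \<in> Hom C ?X (?X \<otimes>\<^sub>o ?X)" using tens_hom[OF h(5) h(2)] u by simp
  have n1: "?n \<otimes> \<i>\<d> ?X \<in> Hom C (?X \<otimes>\<^sub>o ?X) ?X" using tens_hom[OF h(4) h(5)] u by simp
  have n2: "\<i>\<d> ?X \<otimes> ?n \<in> Hom C (?X \<otimes>\<^sub>o ?X) ?X" using tens_hom[OF h(5) h(4)] u by simp
  have d1: "?d \<otimes> \<i>\<d> ?X \<in> Hom C (?X \<otimes>\<^sub>o ?X) (?X \<otimes>\<^sub>o ?X \<otimes>\<^sub>o ?X)"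
    using tens_hom[OF h(3) h(5)] a by simp
  have d2: "\<i>\<d> ?X \<otimes> ?d \<in> Hom C (?X \<otimes>\<^sub>o ?X) (?X \<otimes>\<^sub>o ?X \<otimes>\<^sub>o ?X)"
    using tens_hom[OF h(5) h(3)] by simp
  have m1: "?m \<otimes> \<i>\<d> ?X \<in> Hom C (?X \<otimes>\<^sub>o ?X \<otimes>\<^sub>o ?X) (?X \<otimes>\<^sub>o ?X)"
    using tens_hom[OF h(1) h(5)] a by simp
  have m2: "\<i>\<d> ?X \<otimes> ?m \<in> Hom C (?X \<otimes>\<^sub>o ?X \<otimes>\<^sub>o ?X) (?X \<otimes>\<^sub>o ?X)"
    using tens_hom[OF h(5) h(1)] by simp
  have z1: "(\<i>\<d> ?X \<otimes> (?n \<cdot> ?m)) \<cdot> ((?d \<cdot> ?e) \<otimes> \<i>\<d> ?X) = \<i>\<d> ?X"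
    using zigzag_shape[OF e1 d1 m2 n2 h(1) h(3) frobenius_left]
    by (simp add: tens_comp_id_left[OF h(1) h(4) X] tens_comp_id_right[OF h(2) h(3) X]
        comult_counit_right mult_unit_left id_left[OF h(5)])
  have z2: "((?n \<cdot> ?m) \<otimes> \<i>\<d> ?X) \<cdot> (\<i>\<d> ?X \<otimes> (?d \<cdot> ?e)) = \<i>\<d> ?X"
    using zigzag_shape[OF e2 d2 m1 n1 h(1) h(3) frobenius_right[symmetric]]
    by (simp add: tens_comp_id_right[OF h(1) h(4) X] tens_comp_id_left[OF h(2) h(3) X]
        comult_counit_left mult_unit_right id_left[OF h(5)])
  show ?thesis
    by unfold_locales
      (simp_all add: self_dual_def X z1 z2 comp_hom[OF h(4) h(1)] comp_hom[OF h(3) h(2)])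
qed

end

theory Submission
  imports Defs
begin

text \<open>Write \<open>h = f\<^sup>*\<close>, \<open>\<langle>x, y\<rangle> = \<epsilon>(xy)\<close> and \<open>\<Sum> a\<^sub>i \<otimes> b\<^sub>i = \<delta>(1)\<close>, with primes for the
  corresponding data of \<open>X'\<close>; calculating with elements is a shorthand for string diagrams.
  The definition of \<open>h\<close> amounts to \<open>\<langle>hx, a\<rangle>' = \<langle>x, fa\<rangle>\<close>, or equivalently to
  \<open>\<Sum> a\<^sub>i \<otimes> h b\<^sub>i = \<Sum> f a'\<^sub>i \<otimes> b'\<^sub>i\<close>; the hypothesis \<open>f\<^sup>*\<^sup>* = f\<close>, that is \<open>f = h\<^sup>*\<close>, gives the
  mirror image \<open>\<Sum> h a\<^sub>i \<otimes> b\<^sub>i = \<Sum> a'\<^sub>i \<otimes> f b'\<^sub>i\<close>. In a Frobenius algebra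
  \<open>\<delta>(x) = \<Sum> x a\<^sub>i \<otimes> b\<^sub>i = \<Sum> a\<^sub>i \<otimes> b\<^sub>i x\<close>, so that \<open>\<delta>\<close> is controlled by the multiplication and
  \<open>\<delta>(1)\<close>. Since \<open>f\<close> is multiplicative,
  \<open>(h \<otimes> 1) \<delta> (f y) = \<Sum> h a\<^sub>i \<otimes> b\<^sub>i f(y) = \<Sum> a'\<^sub>i \<otimes> f(b'\<^sub>i) f(y) = (1 \<otimes> f) \<delta>' y\<close>,
  and likewise \<open>(1 \<otimes> h) \<delta> f = (f \<otimes> 1) \<delta>'\<close> (lemmas \<open>comult_f_left\<close>, \<open>comult_f_right\<close>). Dually to
  \<open>f\<close> being an algebra morphism, \<open>h\<close> is a coalgebra morphism, \<open>\<delta>' h = (h \<otimes> h) \<delta>\<close> (lemma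
  \<open>h_comult\<close>). Hence
  \<open>(fh \<otimes> 1) \<delta> fh = (f \<otimes> 1) (1 \<otimes> f) \<delta>' h = (f \<otimes> f) (h \<otimes> h) \<delta>\<close>, and the other half of the
  claim follows in the same way from \<open>comult_f_right\<close>.\<close>

section \<open>Calculating in a strict monoidal category\<close>

context strict_monoidal_category
begin

lemma Hom_iff: "f \<in> Hom C X Y \<longleftrightarrow> f \<in> Arr C \<and> Dom C f = X \<and> Cod C f = Y"
  by (auto simp: Hom_def)

lemma comp_types:
  assumes "f \<in> Arr C" "g \<in> Arr C" "Cod C f = Dom C g"
  shows "g \<cdot> f \<in> Arr C" "Dom C (g \<cdot> f) = Dom C f" "Cod C (g \<cdot> f) = Cod C g"
  using comp_hom[of g "Dom C g" "Cod C g" f "Dom C f"] assms by (auto simp: Hom_iff)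

lemma tens_types:
  assumes "f \<in> Arr C" "g \<in> Arr C"
  shows "f \<otimes> g \<in> Arr C" "Dom C (f \<otimes> g) = Dom C f \<otimes>\<^sub>o Dom C g"
    "Cod C (f \<otimes> g) = Cod C f \<otimes>\<^sub>o Cod C g"
  using tens_hom[of f "Dom C f" "Cod C f" g "Dom C g" "Cod C g"] assms by (auto simp: Hom_iff)

lemma id_types:
  assumes "X \<in> Ob C"
  shows "\<i>\<d> X \<in> Arr C" "Dom C (\<i>\<d> X) = X" "Cod C (\<i>\<d> X) = X"
  using id_hom[OF assms] by (auto simp: Hom_iff)

lemma comp_id:
  assumes "f \<in> Arr C"
  shows "Cod C f = Y \<Longrightarrow> \<i>\<d> Y \<cdot> f = f" "Dom C f = X \<Longrightarrow> f \<cdot> \<i>\<d> X = f"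
  using id_left[of f] id_right[of f] assms by (auto simp: Hom_iff)

lemma comp_assoc_arr:
  assumes "f \<in> Arr C" "g \<in> Arr C" "h \<in> Arr C" "Cod C f = Dom C g" "Cod C g = Dom C h"
  shows "(h \<cdot> g) \<cdot> f = h \<cdot> (g \<cdot> f)"
  using comp_assoc[of h "Dom C h" "Cod C h" g "Dom C g" f] assms by (auto simp: Hom_iff)

lemma interchange_arr:
  assumes "f \<in> Arr C" "f' \<in> Arr C" "g \<in> Arr C" "g' \<in> Arr C"
    "Cod C f = Dom C f'" "Cod C g = Dom C g'"
  shows "(f' \<otimes> g') \<cdot> (f \<otimes> g) = (f' \<cdot> f) \<otimes> (g' \<cdot> g)"
  using interchange[of f "Dom C f" "Dom C f'" f' "Cod C f'" g "Dom C g" "Dom C g'" g' "Cod C g'"]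
    assms by (auto simp: Hom_iff)

lemma whisker_comp:
  assumes "f \<in> Arr C" "g \<in> Arr C" "Cod C f = Dom C g" "W \<in> Ob C"
  shows "(g \<cdot> f) \<otimes> \<i>\<d> W = (g \<otimes> \<i>\<d> W) \<cdot> (f \<otimes> \<i>\<d> W)"
    "\<i>\<d> W \<otimes> (g \<cdot> f) = (\<i>\<d> W \<otimes> g) \<cdot> (\<i>\<d> W \<otimes> f)"
  using tens_comp_id_right[of f _ _ g _ W] tens_comp_id_left[of f _ _ g _ W] assms
  by (auto simp: Hom_iff)

lemma comp_id_tens:
  assumes "f \<in> Arr C" "X \<in> Ob C" "Y \<in> Ob C"
  shows "Cod C f = X \<otimes>\<^sub>o Y \<Longrightarrow> (\<i>\<d> X \<otimes> \<i>\<d> Y) \<cdot> f = f"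
    "Dom C f = X \<otimes>\<^sub>o Y \<Longrightarrow> f \<cdot> (\<i>\<d> X \<otimes> \<i>\<d> Y) = f"
  using assms by (simp_all add: tens_id comp_id)

text \<open>The rules are phrased with \<open>Dom\<close> and \<open>Cod\<close> instead of \<open>Hom\<close>, so that rewriting itself
  computes the types which their side conditions ask for. There are two opposite ways to use
  the interchange law: \<open>slice_simps\<close> cuts a composite next to identity strands into horizontal
  slices, and \<open>merge_simps\<close> composes strand by strand. Sliced diagrams are what whiskered
  equations can be applied to; there, boxes move past each other only by the lemma \<open>slide\<close>.\<close>

lemmas typing = comp_types tens_types id_types tens_ob tens_ob_assoc
  unit_ob tens_ob_unit_left tens_ob_unit_right

lemmas slice_simps = typing comp_id comp_id_tens comp_assoc_arr whisker_comp tens_id[symmetric]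
  tens_assoc tens_unit_left tens_unit_right

lemmas merge_simps = typing comp_id comp_id_tens comp_assoc_arr interchange_arr tens_id[symmetric]
  tens_assoc tens_unit_left tens_unit_right

lemma slide:
  assumes "a \<in> Arr C" "b \<in> Arr C"
  shows "(\<i>\<d> (Cod C a) \<otimes> b) \<cdot> (a \<otimes> \<i>\<d> (Dom C b)) = a \<otimes> b"
    "(a \<otimes> \<i>\<d> (Cod C b)) \<cdot> (\<i>\<d> (Dom C a) \<otimes> b) = a \<otimes> b"
  using assms by (simp_all add: merge_simps dom_ob cod_ob)

end

section \<open>Transposes and the duality morphisms\<close>

locale left_dual_pair = D: left_dual C X D + E: left_dual C Y E
  for C :: "('o, 'a, 'z) moncat_scheme" (structure) and X D Y E +
  fixes f :: 'a
  assumes f_hom: "f \<in> Hom C X Y"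
begin

abbreviation "X' \<equiv> dual_ob D"
abbreviation "Y' \<equiv> dual_ob E"
abbreviation "h \<equiv> transpose C D E f"

lemmas types = f_hom[unfolded D.Hom_iff] D.ev_hom[unfolded D.Hom_iff]
  D.coev_hom[unfolded D.Hom_iff] E.ev_hom[unfolded D.Hom_iff] E.coev_hom[unfolded D.Hom_iff]
  D.ob D.dual_ob E.ob E.dual_ob

lemma transpose_hom: "h \<in> Hom C Y' X'"
  by (simp add: transpose_def D.Hom_iff D.typing types)

text \<open>The box \<open>ev D\<close> slides down past \<open>ev E\<close> and \<open>f\<close> until it meets \<open>coev D\<close>, where
  a zigzag identity straightens the strand.\<close>

lemma ev_transpose: "ev D \<cdot> (h \<otimes> \<i>\<d> X) = ev E \<cdot> (\<i>\<d> Y' \<otimes> f)"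
proof -
  note evs = D.slide[of "ev E" "ev D"] D.slide[of f "ev D"]
  note [simp] = D.slice_simps types
  have "ev D \<cdot> (h \<otimes> \<i>\<d> X) = (ev D \<cdot> (ev E \<otimes> \<i>\<d> X' \<otimes> \<i>\<d> X)) \<cdot> (\<i>\<d> Y' \<otimes> f \<otimes> \<i>\<d> X' \<otimes> \<i>\<d> X)
      \<cdot> (\<i>\<d> Y' \<otimes> coev D \<otimes> \<i>\<d> X)"
    by (simp add: transpose_def)
  also have "ev D \<cdot> (ev E \<otimes> \<i>\<d> X' \<otimes> \<i>\<d> X) = ev E \<cdot> (\<i>\<d> Y' \<otimes> \<i>\<d> Y \<otimes> ev D)"
    using evs by simp
  also have "(ev E \<cdot> (\<i>\<d> Y' \<otimes> \<i>\<d> Y \<otimes> ev D)) \<cdot> (\<i>\<d> Y' \<otimes> f \<otimes> \<i>\<d> X' \<otimes> \<i>\<d> X)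
      \<cdot> (\<i>\<d> Y' \<otimes> coev D \<otimes> \<i>\<d> X)
    = ev E \<cdot> (\<i>\<d> Y' \<otimes> ((\<i>\<d> Y \<otimes> ev D) \<cdot> (f \<otimes> \<i>\<d> X' \<otimes> \<i>\<d> X))) \<cdot> (\<i>\<d> Y' \<otimes> coev D \<otimes> \<i>\<d> X)"
    by simp
  also have "(\<i>\<d> Y \<otimes> ev D) \<cdot> (f \<otimes> \<i>\<d> X' \<otimes> \<i>\<d> X) = f \<cdot> (\<i>\<d> X \<otimes> ev D)"
    using evs by simp
  also have "ev E \<cdot> (\<i>\<d> Y' \<otimes> (f \<cdot> (\<i>\<d> X \<otimes> ev D))) \<cdot> (\<i>\<d> Y' \<otimes> coev D \<otimes> \<i>\<d> X)
    = ev E \<cdot> (\<i>\<d> Y' \<otimes> f) \<cdot> (\<i>\<d> Y' \<otimes> ((\<i>\<d> X \<otimes> ev D) \<cdot> (coev D \<otimes> \<i>\<d> X)))"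
    by simp
  also have "\<dots> = ev E \<cdot> (\<i>\<d> Y' \<otimes> f)"
    by (simp only: D.zigzag_ob) simp
  finally show ?thesis .
qed

text \<open>The mirror image in the vertical direction: \<open>coev D\<close> and \<open>f\<close> slide below \<open>coev E\<close>, and
  the zigzag of \<open>E\<close> is straightened.\<close>

lemma coev_transpose: "(\<i>\<d> Y \<otimes> h) \<cdot> coev E = (f \<otimes> \<i>\<d> X') \<cdot> coev D"
proof -
  note coevs = D.slide[of "coev E" "coev D"] D.slide[of "coev E" f]
  note [simp] = D.slice_simps types
  have "(\<i>\<d> Y \<otimes> h) \<cdot> coev E = (\<i>\<d> Y \<otimes> ev E \<otimes> \<i>\<d> X') \<cdot> (\<i>\<d> Y \<otimes> \<i>\<d> Y' \<otimes> f \<otimes> \<i>\<d> X')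
      \<cdot> ((\<i>\<d> Y \<otimes> \<i>\<d> Y' \<otimes> coev D) \<cdot> coev E)"
    by (simp add: transpose_def)
  also have "(\<i>\<d> Y \<otimes> \<i>\<d> Y' \<otimes> coev D) \<cdot> coev E = (coev E \<otimes> \<i>\<d> X \<otimes> \<i>\<d> X') \<cdot> coev D"
    using coevs by simp
  also have "(\<i>\<d> Y \<otimes> ev E \<otimes> \<i>\<d> X') \<cdot> (\<i>\<d> Y \<otimes> \<i>\<d> Y' \<otimes> f \<otimes> \<i>\<d> X')
      \<cdot> ((coev E \<otimes> \<i>\<d> X \<otimes> \<i>\<d> X') \<cdot> coev D)
    = (\<i>\<d> Y \<otimes> ev E \<otimes> \<i>\<d> X')
      \<cdot> (((\<i>\<d> Y \<otimes> \<i>\<d> Y' \<otimes> f) \<cdot> (coev E \<otimes> \<i>\<d> X)) \<otimes> \<i>\<d> X') \<cdot> coev D"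
    by simp
  also have "(\<i>\<d> Y \<otimes> \<i>\<d> Y' \<otimes> f) \<cdot> (coev E \<otimes> \<i>\<d> X) = (coev E \<otimes> \<i>\<d> Y) \<cdot> f"
    using coevs by simp
  also have "(\<i>\<d> Y \<otimes> ev E \<otimes> \<i>\<d> X') \<cdot> (((coev E \<otimes> \<i>\<d> Y) \<cdot> f) \<otimes> \<i>\<d> X') \<cdot> coev D
    = (((\<i>\<d> Y \<otimes> ev E) \<cdot> (coev E \<otimes> \<i>\<d> Y)) \<otimes> \<i>\<d> X') \<cdot> (f \<otimes> \<i>\<d> X') \<cdot> coev D"
    by simp
  also have "\<dots> = (f \<otimes> \<i>\<d> X') \<cdot> coev D"
    by (simp only: E.zigzag_ob) simp
  finally show ?thesis .
qed

end

text \<open>Bending the strand \<open>X\<close> of \<open>ev D \<cdot> (u \<otimes> \<i>\<d> X)\<close> back up with \<open>coev D\<close> recovers \<open>u\<close>.\<close>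

lemma (in left_dual) ev_nondegenerate:
  assumes "u \<in> Hom C W (dual_ob D)" "v \<in> Hom C W (dual_ob D)"
    and eq: "ev D \<cdot> (u \<otimes> \<i>\<d> X) = ev D \<cdot> (v \<otimes> \<i>\<d> X)"
  shows "u = v"
proof -
  note types = ev_hom[unfolded Hom_iff] coev_hom[unfolded Hom_iff] ob dual_ob
  have recover: "w = ((ev D \<cdot> (w \<otimes> \<i>\<d> X)) \<otimes> \<i>\<d> (dual_ob D)) \<cdot> (\<i>\<d> W \<otimes> coev D)"
    if "w \<in> Hom C W (dual_ob D)" for w
  proof -
    note w = that[unfolded Hom_iff]
    have W: "W \<in> Ob C"
      using HomD[OF that] by blast
    note [simp] = slice_simps types w W
    have "((ev D \<cdot> (w \<otimes> \<i>\<d> X)) \<otimes> \<i>\<d> (dual_ob D)) \<cdot> (\<i>\<d> W \<otimes> coev D)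
        = (ev D \<otimes> \<i>\<d> (dual_ob D)) \<cdot> ((w \<otimes> \<i>\<d> X \<otimes> \<i>\<d> (dual_ob D)) \<cdot> (\<i>\<d> W \<otimes> coev D))"
      by simp
    also have "(w \<otimes> \<i>\<d> X \<otimes> \<i>\<d> (dual_ob D)) \<cdot> (\<i>\<d> W \<otimes> coev D)
        = (\<i>\<d> (dual_ob D) \<otimes> coev D) \<cdot> w"
      using slide[of w "coev D"] by simp
    also have "(ev D \<otimes> \<i>\<d> (dual_ob D)) \<cdot> ((\<i>\<d> (dual_ob D) \<otimes> coev D) \<cdot> w)
        = ((ev D \<otimes> \<i>\<d> (dual_ob D)) \<cdot> (\<i>\<d> (dual_ob D) \<otimes> coev D)) \<cdot> w"
      by simp
    also have "\<dots> = w"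
      by (simp only: zigzag_dual) simp
    finally show ?thesis
      by simp
  qed
  show ?thesis
    using recover[OF assms(1)] recover[OF assms(2)] eq by simp
qed


section \<open>Comultiplication from the self-duality\<close>

context frobenius_algebra
begin

abbreviation "cup \<equiv> coev (self_dual C A)"
abbreviation "cap \<equiv> ev (self_dual C A)"

lemma cup_hom: "cup \<in> Hom C \<one> (frob_ob A \<otimes>\<^sub>o frob_ob A)"
  using left_dual.coev_hom[OF left_dual_self] by (simp add: self_dual_def)

lemma cap_hom: "cap \<in> Hom C (frob_ob A \<otimes>\<^sub>o frob_ob A) \<one>"
  using left_dual.ev_hom[OF left_dual_self] by (simp add: self_dual_def)

lemmas types = cup_hom[unfolded Hom_iff] cap_hom[unfolded Hom_iff]
  mult_hom[unfolded Hom_iff] comult_hom[unfolded Hom_iff] unit_hom[unfolded Hom_iff]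
  counit_hom[unfolded Hom_iff] alg_ob

text \<open>The Frobenius relation precomposed with the unit: \<open>\<delta>\<close> is determined by multiplication
  and \<open>\<delta>(1)\<close>, for which \<open>cup\<close> stands.\<close>

lemma comult_via_cup_right:
  "frob_comult A = (frob_mult A \<otimes> \<i>\<d> (frob_ob A)) \<cdot> (\<i>\<d> (frob_ob A) \<otimes> cup)"
proof -
  note [simp] = slice_simps types
  have "frob_comult A = (frob_comult A \<cdot> frob_mult A) \<cdot> (\<i>\<d> (frob_ob A) \<otimes> frob_unit A)"
    using mult_unit_right by simp
  also have "\<dots> = (frob_mult A \<otimes> \<i>\<d> (frob_ob A)) \<cdot> (\<i>\<d> (frob_ob A) \<otimes> cup)"
    by (simp only: frobenius_right) (simp add: self_dual_def)
  finally show ?thesis .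
qed

lemma comult_via_cup_left:
  "frob_comult A = (\<i>\<d> (frob_ob A) \<otimes> frob_mult A) \<cdot> (cup \<otimes> \<i>\<d> (frob_ob A))"
proof -
  note [simp] = slice_simps types
  have "frob_comult A = (frob_comult A \<cdot> frob_mult A) \<cdot> (frob_unit A \<otimes> \<i>\<d> (frob_ob A))"
    using mult_unit_left by simp
  also have "\<dots> = (\<i>\<d> (frob_ob A) \<otimes> frob_mult A) \<cdot> (cup \<otimes> \<i>\<d> (frob_ob A))"
    by (simp only: frobenius_left[symmetric]) (simp add: self_dual_def)
  finally show ?thesis .
qed

lemma cap_mult: "cap \<cdot> (frob_mult A \<otimes> \<i>\<d> (frob_ob A)) = cap \<cdot> (\<i>\<d> (frob_ob A) \<otimes> frob_mult A)"
  using mult_assoc by (simp add: self_dual_def slice_simps types)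

end

section \<open>Algebra morphisms equal to their double dual\<close>

locale double_dual_algebra_morphism = A: frobenius_algebra C A + B: frobenius_algebra C B
  for C :: "('o, 'a, 'z) moncat_scheme" (structure) and A B :: "('o, 'a) frob_data" +
  fixes f :: 'a
  assumes morphism: "algebra_morphism C A B f"
    and double_dual: "star C B A (star C A B f) = f"
begin

abbreviation "X \<equiv> frob_ob B"
abbreviation "X' \<equiv> frob_ob A"
abbreviation "m \<equiv> frob_mult B"
abbreviation "m' \<equiv> frob_mult A"
abbreviation "\<delta> \<equiv> frob_comult B"
abbreviation "\<delta>' \<equiv> frob_comult A"
abbreviation "h \<equiv> star C A B f"

lemma f_hom: "f \<in> Hom C X' X" and f_mult: "m \<cdot> (f \<otimes> f) = f \<cdot> m'"
  using morphism by (auto simp: algebra_morphism_def)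

lemma self_dual_ob: "dual_ob (self_dual C A) = X'" "dual_ob (self_dual C B) = X"
  by (simp_all add: self_dual_def)

sublocale f_dual: left_dual_pair C X' "self_dual C A" X "self_dual C B" f
  by (intro left_dual_pair.intro left_dual_pair_axioms.intro
      A.left_dual_self B.left_dual_self f_hom)

lemma h_hom: "h \<in> Hom C X X'"
  using f_dual.transpose_hom by (simp add: star_def self_dual_ob)

sublocale h_dual: left_dual_pair C X "self_dual C B" X' "self_dual C A" h
  by (intro left_dual_pair.intro left_dual_pair_axioms.intro
      A.left_dual_self B.left_dual_self h_hom)

lemma cap_h: "A.cap \<cdot> (h \<otimes> \<i>\<d> X') = B.cap \<cdot> (\<i>\<d> X \<otimes> f)"
  using f_dual.ev_transpose by (simp add: star_def self_dual_ob)

lemma h_cup: "(\<i>\<d> X \<otimes> h) \<cdot> B.cup = (f \<otimes> \<i>\<d> X') \<cdot> A.cup"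
  using f_dual.coev_transpose by (simp add: star_def self_dual_ob)

lemma f_cup: "(h \<otimes> \<i>\<d> X) \<cdot> B.cup = (\<i>\<d> X' \<otimes> f) \<cdot> A.cup"
  using h_dual.coev_transpose double_dual by (simp add: star_def self_dual_ob)

lemmas hom_types = f_hom[unfolded A.Hom_iff] h_hom[unfolded A.Hom_iff]

text \<open>In elements, \<open>h(x f(a)) = h(x) a\<close>: the form on \<open>X'\<close> is nondegenerate, and
  \<open>\<langle>h(x f(a)), b\<rangle>' = \<langle>x f(a), f(b)\<rangle> = \<langle>x, f(a) f(b)\<rangle> = \<langle>x, f(ab)\<rangle> = \<langle>hx, ab\<rangle>' = \<langle>(hx) a, b\<rangle>'\<close>.\<close>

lemma h_module: "h \<cdot> m \<cdot> (\<i>\<d> X \<otimes> f) = m' \<cdot> (h \<otimes> \<i>\<d> X')"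
proof -
  note [simp] = A.slice_simps A.types B.types hom_types
  show ?thesis
  proof (rule left_dual.ev_nondegenerate[OF A.left_dual_self])
    show "h \<cdot> m \<cdot> (\<i>\<d> X \<otimes> f) \<in> Hom C (X \<otimes>\<^sub>o X') (dual_ob (self_dual C A))"
      "m' \<cdot> (h \<otimes> \<i>\<d> X') \<in> Hom C (X \<otimes>\<^sub>o X') (dual_ob (self_dual C A))"
      by (simp_all add: A.Hom_iff self_dual_ob)
    have "A.cap \<cdot> ((h \<cdot> m \<cdot> (\<i>\<d> X \<otimes> f)) \<otimes> \<i>\<d> X')
      = (A.cap \<cdot> (h \<otimes> \<i>\<d> X')) \<cdot> (m \<otimes> \<i>\<d> X') \<cdot> (\<i>\<d> X \<otimes> f \<otimes> \<i>\<d> X')"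
      by simp
    also have "\<dots> = B.cap \<cdot> ((\<i>\<d> X \<otimes> f) \<cdot> (m \<otimes> \<i>\<d> X')) \<cdot> (\<i>\<d> X \<otimes> f \<otimes> \<i>\<d> X')"
      by (simp only: cap_h) simp
    also have "(\<i>\<d> X \<otimes> f) \<cdot> (m \<otimes> \<i>\<d> X') = (m \<otimes> \<i>\<d> X) \<cdot> (\<i>\<d> X \<otimes> \<i>\<d> X \<otimes> f)"
      using A.slide[of m f] by simp
    also have "B.cap \<cdot> ((m \<otimes> \<i>\<d> X) \<cdot> (\<i>\<d> X \<otimes> \<i>\<d> X \<otimes> f)) \<cdot> (\<i>\<d> X \<otimes> f \<otimes> \<i>\<d> X')
      = (B.cap \<cdot> (m \<otimes> \<i>\<d> X)) \<cdot> (\<i>\<d> X \<otimes> ((\<i>\<d> X \<otimes> f) \<cdot> (f \<otimes> \<i>\<d> X')))"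
      by simp
    also have "\<dots> = B.cap \<cdot> (\<i>\<d> X \<otimes> (m \<cdot> (\<i>\<d> X \<otimes> f) \<cdot> (f \<otimes> \<i>\<d> X')))"
      by (simp only: B.cap_mult) simp
    also have "m \<cdot> (\<i>\<d> X \<otimes> f) \<cdot> (f \<otimes> \<i>\<d> X') = f \<cdot> m'"
      using A.slide[of f f] f_mult by simp
    also have "B.cap \<cdot> (\<i>\<d> X \<otimes> (f \<cdot> m')) = (B.cap \<cdot> (\<i>\<d> X \<otimes> f)) \<cdot> (\<i>\<d> X \<otimes> m')"
      by simp
    also have "\<dots> = A.cap \<cdot> ((h \<otimes> \<i>\<d> X') \<cdot> (\<i>\<d> X \<otimes> m'))"
      by (simp only: cap_h[symmetric]) simp
    also have "(h \<otimes> \<i>\<d> X') \<cdot> (\<i>\<d> X \<otimes> m') = (\<i>\<d> X' \<otimes> m') \<cdot> (h \<otimes> \<i>\<d> X' \<otimes> \<i>\<d> X')"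
      using A.slide[of h m'] by simp
    also have "A.cap \<cdot> ((\<i>\<d> X' \<otimes> m') \<cdot> (h \<otimes> \<i>\<d> X' \<otimes> \<i>\<d> X'))
      = (A.cap \<cdot> (\<i>\<d> X' \<otimes> m')) \<cdot> (h \<otimes> \<i>\<d> X' \<otimes> \<i>\<d> X')"
      by simp
    also have "\<dots> = A.cap \<cdot> ((m' \<cdot> (h \<otimes> \<i>\<d> X')) \<otimes> \<i>\<d> X')"
      by (simp only: A.cap_mult[symmetric]) simp
    finally show "A.cap \<cdot> ((h \<cdot> m \<cdot> (\<i>\<d> X \<otimes> f)) \<otimes> \<i>\<d> X')
      = A.cap \<cdot> ((m' \<cdot> (h \<otimes> \<i>\<d> X')) \<otimes> \<i>\<d> X')" .
  qed
qed

text \<open>In elements,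
  \<open>\<delta>'(hx) = \<Sum> h(x) a'\<^sub>i \<otimes> b'\<^sub>i = \<Sum> h(x f(a'\<^sub>i)) \<otimes> b'\<^sub>i = \<Sum> h(x a\<^sub>i) \<otimes> h(b\<^sub>i)\<close>.\<close>

lemma h_comult: "\<delta>' \<cdot> h = (h \<otimes> h) \<cdot> \<delta>"
proof -
  note [simp] = A.slice_simps A.types B.types hom_types
  have "\<delta>' \<cdot> h = (m' \<otimes> \<i>\<d> X') \<cdot> ((\<i>\<d> X' \<otimes> A.cup) \<cdot> h)"
    by (simp only: A.comult_via_cup_right) simp
  also have "(\<i>\<d> X' \<otimes> A.cup) \<cdot> h = (h \<otimes> \<i>\<d> X' \<otimes> \<i>\<d> X') \<cdot> (\<i>\<d> X \<otimes> A.cup)"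
    using A.slide[of h A.cup] by simp
  also have "(m' \<otimes> \<i>\<d> X') \<cdot> ((h \<otimes> \<i>\<d> X' \<otimes> \<i>\<d> X') \<cdot> (\<i>\<d> X \<otimes> A.cup))
    = ((m' \<cdot> (h \<otimes> \<i>\<d> X')) \<otimes> \<i>\<d> X') \<cdot> (\<i>\<d> X \<otimes> A.cup)"
    by simp
  also have "\<dots> = ((h \<cdot> m) \<otimes> \<i>\<d> X') \<cdot> (\<i>\<d> X \<otimes> ((f \<otimes> \<i>\<d> X') \<cdot> A.cup))"
    by (simp only: h_module[symmetric]) simp
  also have "\<dots> = (h \<otimes> \<i>\<d> X') \<cdot> ((m \<otimes> \<i>\<d> X') \<cdot> (\<i>\<d> X \<otimes> \<i>\<d> X \<otimes> h)) \<cdot> (\<i>\<d> X \<otimes> B.cup)"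
    by (simp only: h_cup[symmetric]) simp
  also have "(m \<otimes> \<i>\<d> X') \<cdot> (\<i>\<d> X \<otimes> \<i>\<d> X \<otimes> h) = (\<i>\<d> X \<otimes> h) \<cdot> (m \<otimes> \<i>\<d> X)"
    using A.slide[of m h] by simp
  also have "(h \<otimes> \<i>\<d> X') \<cdot> ((\<i>\<d> X \<otimes> h) \<cdot> (m \<otimes> \<i>\<d> X)) \<cdot> (\<i>\<d> X \<otimes> B.cup)
    = ((h \<otimes> \<i>\<d> X') \<cdot> (\<i>\<d> X \<otimes> h)) \<cdot> ((m \<otimes> \<i>\<d> X) \<cdot> (\<i>\<d> X \<otimes> B.cup))"
    by simp
  also have "(h \<otimes> \<i>\<d> X') \<cdot> (\<i>\<d> X \<otimes> h) = h \<otimes> h"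
    using A.slide[of h h] by simp
  finally show ?thesis
    by (simp only: B.comult_via_cup_right[symmetric])
qed

text \<open>In elements,
  \<open>\<Sum> h(a\<^sub>i) \<otimes> b\<^sub>i f(y) = \<Sum> a'\<^sub>i \<otimes> f(b'\<^sub>i) f(y) = \<Sum> a'\<^sub>i \<otimes> f(b'\<^sub>i y)\<close>. This is where
  \<open>f\<^sup>*\<^sup>* = f\<close> enters, through \<open>f_cup\<close>.\<close>

lemma comult_f_left: "(h \<otimes> \<i>\<d> X) \<cdot> \<delta> \<cdot> f = (\<i>\<d> X' \<otimes> f) \<cdot> \<delta>'"
proof -
  note [simp] = A.slice_simps A.types B.types hom_types
  have "(h \<otimes> \<i>\<d> X) \<cdot> \<delta> \<cdot> f
    = ((h \<otimes> \<i>\<d> X) \<cdot> (\<i>\<d> X \<otimes> m)) \<cdot> ((B.cup \<otimes> \<i>\<d> X) \<cdot> f)"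
    by (simp only: B.comult_via_cup_left) simp
  also have "(h \<otimes> \<i>\<d> X) \<cdot> (\<i>\<d> X \<otimes> m) = (\<i>\<d> X' \<otimes> m) \<cdot> (h \<otimes> \<i>\<d> X \<otimes> \<i>\<d> X)"
    using A.slide[of h m] by simp
  also have "((\<i>\<d> X' \<otimes> m) \<cdot> (h \<otimes> \<i>\<d> X \<otimes> \<i>\<d> X)) \<cdot> ((B.cup \<otimes> \<i>\<d> X) \<cdot> f)
    = (\<i>\<d> X' \<otimes> m) \<cdot> (((h \<otimes> \<i>\<d> X) \<cdot> B.cup) \<otimes> \<i>\<d> X) \<cdot> f"
    by simp
  also have "\<dots> = (\<i>\<d> X' \<otimes> m) \<cdot> (\<i>\<d> X' \<otimes> f \<otimes> \<i>\<d> X) \<cdot> ((A.cup \<otimes> \<i>\<d> X) \<cdot> f)"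
    by (simp only: f_cup) simp
  also have "(A.cup \<otimes> \<i>\<d> X) \<cdot> f = (\<i>\<d> X' \<otimes> \<i>\<d> X' \<otimes> f) \<cdot> (A.cup \<otimes> \<i>\<d> X')"
    using A.slide[of A.cup f] by simp
  also have "(\<i>\<d> X' \<otimes> m) \<cdot> (\<i>\<d> X' \<otimes> f \<otimes> \<i>\<d> X) \<cdot> ((\<i>\<d> X' \<otimes> \<i>\<d> X' \<otimes> f) \<cdot> (A.cup \<otimes> \<i>\<d> X'))
    = (\<i>\<d> X' \<otimes> (m \<cdot> (f \<otimes> \<i>\<d> X) \<cdot> (\<i>\<d> X' \<otimes> f))) \<cdot> (A.cup \<otimes> \<i>\<d> X')"
    by simp
  also have "m \<cdot> (f \<otimes> \<i>\<d> X) \<cdot> (\<i>\<d> X' \<otimes> f) = f \<cdot> m'"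
    using A.slide[of f f] f_mult by simp
  also have "(\<i>\<d> X' \<otimes> (f \<cdot> m')) \<cdot> (A.cup \<otimes> \<i>\<d> X')
    = (\<i>\<d> X' \<otimes> f) \<cdot> ((\<i>\<d> X' \<otimes> m') \<cdot> (A.cup \<otimes> \<i>\<d> X'))"
    by simp
  finally show ?thesis
    by (simp only: A.comult_via_cup_left[symmetric])
qed

text \<open>In elements,
  \<open>\<Sum> f(y) a\<^sub>i \<otimes> h(b\<^sub>i) = \<Sum> f(y) f(a'\<^sub>i) \<otimes> b'\<^sub>i = \<Sum> f(y a'\<^sub>i) \<otimes> b'\<^sub>i\<close>.\<close>

lemma comult_f_right: "(\<i>\<d> X \<otimes> h) \<cdot> \<delta> \<cdot> f = (f \<otimes> \<i>\<d> X') \<cdot> \<delta>'"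
proof -
  note [simp] = A.slice_simps A.types B.types hom_types
  have "(\<i>\<d> X \<otimes> h) \<cdot> \<delta> \<cdot> f
    = ((\<i>\<d> X \<otimes> h) \<cdot> (m \<otimes> \<i>\<d> X)) \<cdot> ((\<i>\<d> X \<otimes> B.cup) \<cdot> f)"
    by (simp only: B.comult_via_cup_right) simp
  also have "(\<i>\<d> X \<otimes> h) \<cdot> (m \<otimes> \<i>\<d> X) = (m \<otimes> \<i>\<d> X') \<cdot> (\<i>\<d> X \<otimes> \<i>\<d> X \<otimes> h)"
    using A.slide[of m h] by simp
  also have "((m \<otimes> \<i>\<d> X') \<cdot> (\<i>\<d> X \<otimes> \<i>\<d> X \<otimes> h)) \<cdot> ((\<i>\<d> X \<otimes> B.cup) \<cdot> f)
    = (m \<otimes> \<i>\<d> X') \<cdot> (\<i>\<d> X \<otimes> ((\<i>\<d> X \<otimes> h) \<cdot> B.cup)) \<cdot> f"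
    by simp
  also have "\<dots> = (m \<otimes> \<i>\<d> X') \<cdot> (\<i>\<d> X \<otimes> f \<otimes> \<i>\<d> X') \<cdot> ((\<i>\<d> X \<otimes> A.cup) \<cdot> f)"
    by (simp only: h_cup) simp
  also have "(\<i>\<d> X \<otimes> A.cup) \<cdot> f = (f \<otimes> \<i>\<d> X' \<otimes> \<i>\<d> X') \<cdot> (\<i>\<d> X' \<otimes> A.cup)"
    using A.slide[of f A.cup] by simp
  also have "(m \<otimes> \<i>\<d> X') \<cdot> (\<i>\<d> X \<otimes> f \<otimes> \<i>\<d> X') \<cdot> ((f \<otimes> \<i>\<d> X' \<otimes> \<i>\<d> X') \<cdot> (\<i>\<d> X' \<otimes> A.cup))
    = ((m \<cdot> (\<i>\<d> X \<otimes> f) \<cdot> (f \<otimes> \<i>\<d> X')) \<otimes> \<i>\<d> X') \<cdot> (\<i>\<d> X' \<otimes> A.cup)"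
    by simp
  also have "m \<cdot> (\<i>\<d> X \<otimes> f) \<cdot> (f \<otimes> \<i>\<d> X') = f \<cdot> m'"
    using A.slide[of f f] f_mult by simp
  also have "((f \<cdot> m') \<otimes> \<i>\<d> X') \<cdot> (\<i>\<d> X' \<otimes> A.cup)
    = (f \<otimes> \<i>\<d> X') \<cdot> ((m' \<otimes> \<i>\<d> X') \<cdot> (\<i>\<d> X' \<otimes> A.cup))"
    by simp
  finally show ?thesis
    by (simp only: A.comult_via_cup_right[symmetric])
qed

abbreviation "g \<equiv> f \<cdot> h"

lemma tens_g: "(f \<otimes> f) \<cdot> (h \<otimes> h) \<cdot> \<delta> = (g \<otimes> g) \<cdot> \<delta>"
  using A.comp_assoc_arr[of \<delta> "h \<otimes> h" "f \<otimes> f"]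
  by (simp add: A.merge_simps A.types B.types hom_types)

lemma g_comult_left: "(g \<otimes> \<i>\<d> X) \<cdot> \<delta> \<cdot> g = (g \<otimes> g) \<cdot> \<delta>"
proof -
  note [simp] = A.slice_simps A.types B.types hom_types
  have "(g \<otimes> \<i>\<d> X) \<cdot> \<delta> \<cdot> g = (f \<otimes> \<i>\<d> X) \<cdot> ((h \<otimes> \<i>\<d> X) \<cdot> \<delta> \<cdot> f) \<cdot> h"
    by simp
  also have "\<dots> = ((f \<otimes> \<i>\<d> X) \<cdot> (\<i>\<d> X' \<otimes> f)) \<cdot> (\<delta>' \<cdot> h)"
    by (simp only: comult_f_left) simp
  also have "(f \<otimes> \<i>\<d> X) \<cdot> (\<i>\<d> X' \<otimes> f) = f \<otimes> f"
    using A.slide[of f f] by simp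
  finally show ?thesis
    by (simp only: h_comult tens_g)
qed

lemma g_comult_right: "(\<i>\<d> X \<otimes> g) \<cdot> \<delta> \<cdot> g = (g \<otimes> g) \<cdot> \<delta>"
proof -
  note [simp] = A.slice_simps A.types B.types hom_types
  have "(\<i>\<d> X \<otimes> g) \<cdot> \<delta> \<cdot> g = (\<i>\<d> X \<otimes> f) \<cdot> ((\<i>\<d> X \<otimes> h) \<cdot> \<delta> \<cdot> f) \<cdot> h"
    by simp
  also have "\<dots> = ((\<i>\<d> X \<otimes> f) \<cdot> (f \<otimes> \<i>\<d> X')) \<cdot> (\<delta>' \<cdot> h)"
    by (simp only: comult_f_right) simp
  also have "(\<i>\<d> X \<otimes> f) \<cdot> (f \<otimes> \<i>\<d> X') = f \<otimes> f"
    using A.slide[of f f] by simp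
  finally show ?thesis
    by (simp only: h_comult tens_g)
qed

end

theorem theorem3p26:
  fixes C :: "('o, 'a, 'z) moncat_scheme" (structure)
    and X X' :: "('o, 'a) frob_data"
    and f g :: 'a
  assumes "strict_monoidal_category C"
    and "frobenius_algebra C X"
    and "frobenius_algebra C X'"
    and "algebra_morphism C X' X f"
    and "star C X X' (star C X' X f) = f"
    and "g = f \<cdot> star C X' X f"
  shows "(g \<otimes> \<i>\<d> (frob_ob X)) \<cdot> frob_comult X \<cdot> g = (g \<otimes> g) \<cdot> frob_comult X
    \<and> (g \<otimes> g) \<cdot> frob_comult X = (\<i>\<d> (frob_ob X) \<otimes> g) \<cdot> frob_comult X \<cdot> g"
proof -
  interpret double_dual_algebra_morphism C X' X f
    using assms by (intro double_dual_algebra_morphism.intro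
        double_dual_algebra_morphism_axioms.intro)
  show ?thesis
    using g_comult_left g_comult_right by (simp add: assms(6))
qed

end
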